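(* Let $G$ be a braided simplicial group, let $n\ge2$, and let $x\in G_n(\tilde B_{n+1})$, where $G_n(\tilde B_{n+1})=\{x\in G_n\mid\sigma(x)\simeq x\text{ for all }\sigma\in\tilde B_{n+1}\}$. Then: 1) $d_j(x)=d_{j+2}(x)$ for each $j$ with $0\le j\le n-2$; 2) $\sigma_kd_j(x)=d_{j+1}(x)$ for each $j,k$ with $0\le j\le n-1$ and $-1\le k\le n-3$; 3) $d_j(x)\in G_{n-1}$ is a fixed point of $\tilde B_n$ for each $0\le j\le n$. In particular, if $d_jx=1$ for some $j$, then $x\in\mathcal Z(G)_n$.
   Context: Braided simplicial groups: a simplicial group $G=(G_n,d_j,s_j)$ is braided if for every $n\ge0$ there is an action by group automorphisms of the braid group $B_{n+1}$ on $G_n$, where the standard generators of $B_{n+1}$ are labelled $\sigma_{-1},\sigma_0,\dots,\sigma_{n-2}$, such that for all $n$, all $-1\le k\le n-2$ and $0\le j\le n$ the following hold on $G_n$ (composition right to left): $d_j\sigma_k=\sigma_{k-1}d_j$ if $j\le k$, $d_{k+1}\sigma_k=d_{k+2}$, $d_{k+2}\sigma_k=d_{k+1}$, $d_j\sigma_k=\sigma_kd_j$ if $j>k+2$; $s_j\sigma_k=\sigma_{k+1}s_j$ if $j\le k$, $s_{k+1}\sigma_k=\sigma_{k+1}\sigma_ks_{k+2}$, $s_{k+2}\sigma_k=\sigma_k\sigma_{k+1}s_{k+1}$, $s_j\sigma_k=\sigma_ks_j$ if $j>k+2$. Cycles: $\mathcal Z(G)_n=\{x\in G_n\mid d_jx=1\text{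 for all }j\}$. Boundaries: $\mathcal B(G)_n=\{d_0x\mid x\in G_{n+1},\ d_jx=1\text{ for all }j>0\}$. For $x,y\in G_n$, write $x\simeq y$ if $xy^{-1}\in\mathcal B(G)_n$. $\tilde B_{m}$ is the kernel of the composite $B_{m}\to\Sigma_{m}\xrightarrow{\ \mathrm{sign}\ }\mathbb Z/2$. *)

theory Defs
  imports "HOL-Algebra.Bij" "HOL-Algebra.Sym_Groups"
begin

section \<open>Braid groups\<close>

text \<open>
  The braid group on \<open>m\<close> strands is given by the Artin presentation. Its generators are labelled
  \<open>\<sigma>\<^sub>k\<close> with \<open>- 1 \<le> k \<le> m - 3\<close>, hence the integer labels. A letter \<open>(k, True)\<close> stands for
  \<open>\<sigma>\<^sub>k\<close> and \<open>(k, False)\<close> for its formal inverse.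
\<close>

type_synonym braid_word = "(int \<times> bool) list"

definition braid_labels :: "nat \<Rightarrow> int set"
  where "braid_labels m = {- 1 .. int m - 3}"

definition braid_words :: "nat \<Rightarrow> braid_word set"
  where "braid_words m = lists (braid_labels m \<times> UNIV)"

inductive_set braid_rel :: "nat \<Rightarrow> (braid_word \<times> braid_word) set" for m :: nat where
  refl: "w \<in> braid_words m \<Longrightarrow> (w, w) \<in> braid_rel m"
| sym: "(v, w) \<in> braid_rel m \<Longrightarrow> (w, v) \<in> braid_rel m"
| trans: "(u, v) \<in> braid_rel m \<Longrightarrow> (v, w) \<in> braid_rel m \<Longrightarrow> (u, w) \<in> braid_rel m"
| append: "(v, w) \<in> braid_rel m \<Longrightarrow> (v', w') \<in> braid_rel m \<Longrightarrow> (v @ v', w @ w') \<in> braid_rel m"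
| cancel: "k \<in> braid_labels m \<Longrightarrow> ([(k, b), (k, \<not> b)], []) \<in> braid_rel m"
| commute: "k \<in> braid_labels m \<Longrightarrow> l \<in> braid_labels m \<Longrightarrow> \<bar>k - l\<bar> \<ge> 2 \<Longrightarrow>
    ([(k, True), (l, True)], [(l, True), (k, True)]) \<in> braid_rel m"
| braid: "k \<in> braid_labels m \<Longrightarrow> k + 1 \<in> braid_labels m \<Longrightarrow>
    ([(k, True), (k + 1, True), (k, True)], [(k + 1, True), (k, True), (k + 1, True)])
      \<in> braid_rel m"

definition braid_group :: "nat \<Rightarrow> braid_word set monoid"
  where "braid_group m =
    \<lparr>carrier = braid_words m // braid_rel m,
     monoid.mult = (\<lambda>A B. \<Union>v\<in>A. \<Union>w\<in>B. braid_rel m `` {v @ w}),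
     one = braid_rel m `` {[]}\<rparr>"

definition braid_gen :: "nat \<Rightarrow> int \<Rightarrow> braid_word set"
  where "braid_gen m k = braid_rel m `` {[(k, True)]}"

text \<open>
  The projection to the symmetric group on \<open>{1..m}\<close> maps \<open>\<sigma>\<^sub>k\<close> to the transposition of
  \<open>k + 2\<close> and \<open>k + 3\<close>. By the lemma \<open>braid_rel_word_perm\<close> below, it is constant on classes.
\<close>

fun word_perm :: "braid_word \<Rightarrow> nat \<Rightarrow> nat" where
  "word_perm [] = id"
| "word_perm ((k, b) # w) = transpose (nat (k + 2)) (nat (k + 3)) \<circ> word_perm w"

definition braid_perm :: "braid_word set \<Rightarrow> nat \<Rightarrow> nat"
  where "braid_perm A = the_elem (word_perm ` A)"

definition even_braids :: "nat \<Rightarrow> braid_word set set"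
  where "even_braids m = kernel (braid_group m) sign_img (sign \<circ> braid_perm)"

lemma equiv_braid_rel: "equiv (braid_words m) (braid_rel m)"
proof (rule equivI)
  have "v \<in> braid_words m \<and> w \<in> braid_words m" if "(v, w) \<in> braid_rel m" for v w
    using that by induction (auto simp: braid_words_def)
  then show "braid_rel m \<subseteq> braid_words m \<times> braid_words m"
    by auto
  show "refl_on (braid_words m) (braid_rel m)"
    by (simp add: refl_on_def braid_rel.refl)
  show "sym (braid_rel m)"
    by (rule symI) (rule braid_rel.sym)
  show "trans (braid_rel m)"
    by (rule transI) (rule braid_rel.trans)
qed

lemma word_perm_append: "word_perm (v @ w) = word_perm v \<circ> word_perm w"
  by (induction v rule: word_perm.induct) (auto simp: o_assoc)

lemma transpose_disjoint_commute:
  "distinct [a, b, c, e] \<Longrightarrow> transpose a b \<circ> transpose c e = transpose c e \<circ> transpose a b"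
  by (auto simp: fun_eq_iff transpose_def)

lemma transpose_braid:
  "distinct [a, b, c] \<Longrightarrow> transpose a b \<circ> (transpose b c \<circ> transpose a b) =
    transpose b c \<circ> (transpose a b \<circ> transpose b c)"
  by (auto simp: fun_eq_iff transpose_def)

lemma braid_rel_word_perm: "(v, w) \<in> braid_rel m \<Longrightarrow> word_perm v = word_perm w"
proof (induction rule: braid_rel.induct)
  case (commute k l)
  then have "distinct [nat (k + 2), nat (k + 3), nat (l + 2), nat (l + 3)]"
    by (auto simp: braid_labels_def)
  from transpose_disjoint_commute[OF this] show ?case
    by simp
next
  case (braid k)
  then have "nat (k + 1 + 2) = nat (k + 3)"
    and "distinct [nat (k + 2), nat (k + 3), nat (k + 1 + 3)]"
    by (auto simp: braid_labels_def)
  from transpose_braid[OF this(2)] this(1) show ?case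
    by (simp only: word_perm.simps comp_id)
qed (simp_all add: word_perm_append)

lemma word_perm_permutes: "w \<in> braid_words m \<Longrightarrow> word_perm w permutes {1..m}"
proof (induction w rule: word_perm.induct)
  case (2 k b w)
  then have "k \<in> braid_labels m" "w \<in> braid_words m"
    by (auto simp: braid_words_def)
  then have "transpose (nat (k + 2)) (nat (k + 3)) permutes {1..m}" "word_perm w permutes {1..m}"
    using 2 by (auto simp: braid_labels_def intro!: permutes_swap_id)
  then show ?case
    by (simp only: word_perm.simps permutes_compose)
qed (auto simp: permutes_id)

lemma braid_mult_class:
  assumes "v \<in> braid_words m" "w \<in> braid_words m"
  shows "(braid_rel m `` {v}) \<otimes>\<^bsub>braid_group m\<^esub> (braid_rel m `` {w}) = braid_rel m `` {v @ w}"
proof -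
  have "congruent2 (braid_rel m) (braid_rel m) (\<lambda>v w. braid_rel m `` {v @ w})"
    by (auto simp: congruent2_def intro!: equiv_class_eq[OF equiv_braid_rel] braid_rel.append)
  then show ?thesis
    using UN_equiv_class2[OF equiv_braid_rel equiv_braid_rel _ assms]
    by (simp add: braid_group_def)
qed

lemma group_braid_group: "group (braid_group m)"
proof (rule groupI)
  have app: "v @ w \<in> braid_words m" if "v \<in> braid_words m" "w \<in> braid_words m" for v w
    using that by (auto simp: braid_words_def)
  have nil: "[] \<in> braid_words m"
    by (auto simp: braid_words_def)
  have carr: "carrier (braid_group m) = (\<lambda>w. braid_rel m `` {w}) ` braid_words m"
    by (auto simp: braid_group_def quotient_def)
  have one: "\<one>\<^bsub>braid_group m\<^esub> = braid_rel m `` {[]}"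
    by (simp add: braid_group_def)
  show "\<one>\<^bsub>braid_group m\<^esub> \<in> carrier (braid_group m)"
    by (auto simp: one carr nil)
  fix A assume A: "A \<in> carrier (braid_group m)"
  show "A \<otimes>\<^bsub>braid_group m\<^esub> B \<in> carrier (braid_group m)"
    if "B \<in> carrier (braid_group m)" for B
    using A that by (auto simp: carr braid_mult_class app)
  show "A \<otimes>\<^bsub>braid_group m\<^esub> B \<otimes>\<^bsub>braid_group m\<^esub> C = A \<otimes>\<^bsub>braid_group m\<^esub> (B \<otimes>\<^bsub>braid_group m\<^esub> C)"
    if "B \<in> carrier (braid_group m)" "C \<in> carrier (braid_group m)" for B C
    using A that by (auto simp: carr braid_mult_class app)
  show "\<one>\<^bsub>braid_group m\<^esub> \<otimes>\<^bsub>braid_group m\<^esub> A = A"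
    using A by (auto simp: one carr braid_mult_class nil)
  have left_inv: "\<exists>v \<in> braid_words m. (v @ w, []) \<in> braid_rel m" if "w \<in> braid_words m" for w
    using that
  proof (induction w)
    case (Cons a w)
    obtain k b where a: "a = (k, b)" by (cases a)
    then have k: "k \<in> braid_labels m" and w: "w \<in> braid_words m"
      using Cons.prems by (auto simp: braid_words_def)
    with Cons.IH obtain v where v: "v \<in> braid_words m" "(v @ w, []) \<in> braid_rel m"
      by auto
    have "([(k, \<not> b), (k, b)] @ w, [] @ w) \<in> braid_rel m"
      using braid_rel.append[OF braid_rel.cancel[OF k, of "\<not> b"] braid_rel.refl[OF w]] by simp
    then have "(v @ [(k, \<not> b), (k, b)] @ w, v @ [] @ w) \<in> braid_rel m"
      by (rule braid_rel.append[OF braid_rel.refl[OF v(1)]])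
    then have "((v @ [(k, \<not> b)]) @ a # w, []) \<in> braid_rel m"
      using v(2) a by (auto intro: braid_rel.trans)
    moreover have "v @ [(k, \<not> b)] \<in> braid_words m"
      using v(1) k by (auto simp: braid_words_def)
    ultimately show ?case by blast
  qed (auto intro: braid_rel.refl nil)
  obtain w where w: "w \<in> braid_words m" "A = braid_rel m `` {w}"
    using A by (auto simp: carr)
  obtain v where v: "v \<in> braid_words m" "(v @ w, []) \<in> braid_rel m"
    using left_inv[OF w(1)] by blast
  have "braid_rel m `` {v} \<otimes>\<^bsub>braid_group m\<^esub> A = \<one>\<^bsub>braid_group m\<^esub>"
    using equiv_class_eq[OF equiv_braid_rel v(2)] v(1) w by (simp add: braid_mult_class one)
  then show "\<exists>B\<in>carrier (braid_group m). B \<otimes>\<^bsub>braid_group m\<^esub> A = \<one>\<^bsub>braid_group m\<^esub>"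
    using v(1) carr by blast
qed

lemma braid_perm_class:
  assumes "w \<in> braid_words m"
  shows "braid_perm (braid_rel m `` {w}) = word_perm w"
proof -
  have "word_perm ` (braid_rel m `` {w}) = {word_perm w}"
    using assms braid_rel.refl[of w m] by (auto dest: braid_rel_word_perm)
  then show ?thesis
    by (simp add: braid_perm_def)
qed

lemma braid_perm_hom: "braid_perm \<in> hom (braid_group m) (sym_group m)"
proof (rule homI)
  have carr: "carrier (braid_group m) = (\<lambda>w. braid_rel m `` {w}) ` braid_words m"
    by (auto simp: braid_group_def quotient_def)
  fix A assume A: "A \<in> carrier (braid_group m)"
  show "braid_perm A \<in> carrier (sym_group m)"
    using A by (auto simp: carr braid_perm_class sym_group_carrier simp del: One_nat_def intro: word_perm_permutes)
  fix B assume B: "B \<in> carrier (braid_group m)"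
  have app: "v @ w \<in> braid_words m" if "v \<in> braid_words m" "w \<in> braid_words m" for v w
    using that by (auto simp: braid_words_def)
  show "braid_perm (A \<otimes>\<^bsub>braid_group m\<^esub> B) = braid_perm A \<otimes>\<^bsub>sym_group m\<^esub> braid_perm B"
    using A B
    by (auto simp: carr braid_perm_class braid_mult_class app sym_group_mult word_perm_append)
qed

section \<open>Braided simplicial groups\<close>

text \<open>
  \<open>d n j\<close> is the face map \<open>d\<^sub>j\<close> from degree \<open>n\<close> to degree \<open>n - 1\<close> (constrained only for
  \<open>n \<ge> 1\<close>), and \<open>s n j\<close> the degeneracy \<open>s\<^sub>j\<close> from degree \<open>n\<close> to degree \<open>n + 1\<close>.
  Taking all \<open>G n\<close> inside a single type is no restriction, since the groups may be embedded into
  a disjoint union.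
\<close>

locale simplicial_group =
  fixes G :: "nat \<Rightarrow> 'a monoid"
    and d s :: "nat \<Rightarrow> nat \<Rightarrow> 'a \<Rightarrow> 'a"
  assumes group_G: "group (G n)"
    and face_hom: "j \<le> Suc n \<Longrightarrow> d (Suc n) j \<in> hom (G (Suc n)) (G n)"
    and degen_hom: "j \<le> n \<Longrightarrow> s n j \<in> hom (G n) (G (Suc n))"
    and face_face: "\<lbrakk>i < j; j \<le> Suc (Suc n); x \<in> carrier (G (Suc (Suc n)))\<rbrakk> \<Longrightarrow>
      d (Suc n) i (d (Suc (Suc n)) j x) = d (Suc n) (j - 1) (d (Suc (Suc n)) i x)"
    and degen_degen: "\<lbrakk>i \<le> j; j \<le> n; x \<in> carrier (G n)\<rbrakk> \<Longrightarrow>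
      s (Suc n) i (s n j x) = s (Suc n) (Suc j) (s n i x)"
    and face_degen_less: "\<lbrakk>i < j; j \<le> n; x \<in> carrier (G n)\<rbrakk> \<Longrightarrow>
      d (Suc n) i (s n j x) = s (n - 1) (j - 1) (d n i x)"
    and face_degen_same: "\<lbrakk>j \<le> n; x \<in> carrier (G n)\<rbrakk> \<Longrightarrow> d (Suc n) j (s n j x) = x"
    and face_degen_Suc: "\<lbrakk>j \<le> n; x \<in> carrier (G n)\<rbrakk> \<Longrightarrow> d (Suc n) (Suc j) (s n j x) = x"
    and face_degen_greater: "\<lbrakk>Suc j < i; i \<le> Suc n; x \<in> carrier (G n)\<rbrakk> \<Longrightarrow>
      d (Suc n) i (s n j x) = s (n - 1) j (d n (i - 1) x)"

text \<open>
  \<open>act n\<close> is the action of the braid group on \<open>n + 1\<close> strands on \<open>G n\<close>; since multiplication in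
  \<^const>\<open>AutoGroup\<close> is composition, this is a left action. In \<open>face_*\<close> below, a generator
  \<open>\<sigma>\<^sub>k\<close> in degree \<open>n\<close> exists only for \<open>n \<ge> 1\<close>, so \<open>d n j\<close> is always a genuine face map.
\<close>

locale braided_simplicial_group = simplicial_group G d s
  for G :: "nat \<Rightarrow> 'a monoid"
    and d s :: "nat \<Rightarrow> nat \<Rightarrow> 'a \<Rightarrow> 'a" +
  fixes act :: "nat \<Rightarrow> braid_word set \<Rightarrow> 'a \<Rightarrow> 'a"
  assumes act_hom: "act n \<in> hom (braid_group (n + 1)) (AutoGroup (G n))"
    and face_gen_low:
      "\<lbrakk>- 1 \<le> k; k \<le> int n - 2; j \<le> n; int j \<le> k; x \<in> carrier (G n)\<rbrakk> \<Longrightarrow>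
        d n j (act n (braid_gen (n + 1) k) x) = act (n - 1) (braid_gen n (k - 1)) (d n j x)"
    and face_gen_left:
      "\<lbrakk>- 1 \<le> k; k \<le> int n - 2; x \<in> carrier (G n)\<rbrakk> \<Longrightarrow>
        d n (nat (k + 1)) (act n (braid_gen (n + 1) k) x) = d n (nat (k + 2)) x"
    and face_gen_right:
      "\<lbrakk>- 1 \<le> k; k \<le> int n - 2; x \<in> carrier (G n)\<rbrakk> \<Longrightarrow>
        d n (nat (k + 2)) (act n (braid_gen (n + 1) k) x) = d n (nat (k + 1)) x"
    and face_gen_high:
      "\<lbrakk>- 1 \<le> k; k \<le> int n - 2; j \<le> n; int j > k + 2; x \<in> carrier (G n)\<rbrakk> \<Longrightarrow>
        d n j (act n (braid_gen (n + 1) k) x) = act (n - 1) (braid_gen n k) (d n j x)"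
    and degen_gen_low:
      "\<lbrakk>- 1 \<le> k; k \<le> int n - 2; j \<le> n; int j \<le> k; x \<in> carrier (G n)\<rbrakk> \<Longrightarrow>
        s n j (act n (braid_gen (n + 1) k) x) = act (n + 1) (braid_gen (n + 2) (k + 1)) (s n j x)"
    and degen_gen_left:
      "\<lbrakk>- 1 \<le> k; k \<le> int n - 2; x \<in> carrier (G n)\<rbrakk> \<Longrightarrow>
        s n (nat (k + 1)) (act n (braid_gen (n + 1) k) x) =
          act (n + 1) (braid_gen (n + 2) (k + 1))
            (act (n + 1) (braid_gen (n + 2) k) (s n (nat (k + 2)) x))"
    and degen_gen_right:
      "\<lbrakk>- 1 \<le> k; k \<le> int n - 2; x \<in> carrier (G n)\<rbrakk> \<Longrightarrow>
        s n (nat (k + 2)) (act n (braid_gen (n + 1) k) x) =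
          act (n + 1) (braid_gen (n + 2) k)
            (act (n + 1) (braid_gen (n + 2) (k + 1)) (s n (nat (k + 1)) x))"
    and degen_gen_high:
      "\<lbrakk>- 1 \<le> k; k \<le> int n - 2; j \<le> n; int j > k + 2; x \<in> carrier (G n)\<rbrakk> \<Longrightarrow>
        s n j (act n (braid_gen (n + 1) k) x) = act (n + 1) (braid_gen (n + 2) k) (s n j x)"

text \<open>In degree \<open>0\<close> there are no faces, so every element is a cycle.\<close>

definition cycles :: "(nat \<Rightarrow> 'a monoid) \<Rightarrow> (nat \<Rightarrow> nat \<Rightarrow> 'a \<Rightarrow> 'a) \<Rightarrow> nat \<Rightarrow> 'a set"
  where "cycles G d n = {x \<in> carrier (G n). n > 0 \<longrightarrow> (\<forall>j\<le>n. d n j x = \<one>\<^bsub>G (n - 1)\<^esub>)}"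

definition boundaries :: "(nat \<Rightarrow> 'a monoid) \<Rightarrow> (nat \<Rightarrow> nat \<Rightarrow> 'a \<Rightarrow> 'a) \<Rightarrow> nat \<Rightarrow> 'a set"
  where "boundaries G d n =
    {d (n + 1) 0 x | x. x \<in> carrier (G (n + 1)) \<and>
      (\<forall>j. 0 < j \<and> j \<le> n + 1 \<longrightarrow> d (n + 1) j x = \<one>\<^bsub>G n\<^esub>)}"

definition homologous ::
    "(nat \<Rightarrow> 'a monoid) \<Rightarrow> (nat \<Rightarrow> nat \<Rightarrow> 'a \<Rightarrow> 'a) \<Rightarrow> nat \<Rightarrow> 'a \<Rightarrow> 'a \<Rightarrow> bool"
  where "homologous G d n x y \<longleftrightarrow> x \<otimes>\<^bsub>G n\<^esub> inv\<^bsub>G n\<^esub> y \<in> boundaries G d n"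

definition homologically_fixed ::
    "(nat \<Rightarrow> 'a monoid) \<Rightarrow> (nat \<Rightarrow> nat \<Rightarrow> 'a \<Rightarrow> 'a) \<Rightarrow> (nat \<Rightarrow> braid_word set \<Rightarrow> 'a \<Rightarrow> 'a) \<Rightarrow>
      nat \<Rightarrow> braid_word set set \<Rightarrow> 'a set"
  where "homologically_fixed G d act n H =
    {x \<in> carrier (G n). \<forall>\<sigma>\<in>H. homologous G d n (act n \<sigma> x) x}"

end

theory Submission
  imports Defs
begin

text \<open>
  Boundaries are cycles, so homologous elements have equal faces. Hence \<open>d\<^sub>j (\<sigma> x) = d\<^sub>j x\<close> for every
  even braid \<open>\<sigma>\<close>, in particular for every product \<open>\<sigma>\<^sub>k \<sigma>\<^sub>l\<close> of two generators
  (\<open>homologically_fixed_face\<close>). Moving \<open>d\<^sub>j\<close> past such a product yields everything: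

  \<^item> \<open>d\<^sub>j \<sigma>\<^sub>j\<^sub>-\<^sub>1 \<sigma>\<^sub>j = d\<^sub>j\<^sub>+\<^sub>2\<close>, so \<open>d\<^sub>j x = d\<^sub>j\<^sub>+\<^sub>2 x\<close>, and the faces of \<open>x\<close> take only the two values \<open>d\<^sub>0 x\<close>
    and \<open>d\<^sub>1 x\<close>, according to the parity of \<open>j\<close>.

  \<^item> \<open>d\<^sub>0 \<sigma>\<^sub>k\<^sub>+\<^sub>1 \<sigma>\<^sub>-\<^sub>1 = \<sigma>\<^sub>k d\<^sub>1\<close> and \<open>d\<^sub>0 \<sigma>\<^sub>k\<^sub>+\<^sub>1 \<sigma>\<^sub>k\<^sub>+\<^sub>1 = \<sigma>\<^sub>k \<sigma>\<^sub>k d\<^sub>0\<close>, so \<open>\<sigma>\<^sub>k\<close> maps both \<open>d\<^sub>1 x\<close> and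
    \<open>\<sigma>\<^sub>k d\<^sub>0 x\<close> to \<open>d\<^sub>0 x\<close>. As \<open>\<sigma>\<^sub>k\<close> acts injectively, it interchanges \<open>d\<^sub>0 x\<close> and \<open>d\<^sub>1 x\<close>
    (\<open>gen_swaps_faces\<close>).

  A braid is even exactly if it is represented by a word of even length, because each generator
  maps to a transposition. So an even braid interchanges the two values an even number of times and
  fixes both (\<open>even_braids_fix_swapped_pair\<close>). Finally, an automorphism preserves the unit,
  so if one of the two values is the unit, then so is the other one.
\<close>

section \<open>Even braids\<close>

lemma word_perm_permutation: "permutation (word_perm w)"
  by (induction w rule: word_perm.induct)
    (simp_all add: permutation_compose permutation_swap_id del: comp_apply o_apply
      flip: comp_def)

lemma sign_word_perm:
  assumes "w \<in> braid_words m"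
  shows "sign (word_perm w) = (- 1) ^ length w"
  using assms
proof (induction w rule: word_perm.induct)
  case (2 k b w)
  then have k: "k \<in> braid_labels m" and w: "w \<in> braid_words m"
    by (auto simp: braid_words_def)
  \<comment> \<open>Since \<open>k \<ge> - 1\<close>, no truncation by \<^const>\<open>nat\<close> makes this transposition trivial.\<close>
  have "nat (k + 2) \<noteq> nat (k + 3)"
    using k by (auto simp: braid_labels_def)
  then have "sign (transpose (nat (k + 2)) (nat (k + 3))) = - 1"
    by (simp add: sign_swap_id)
  then show ?case
    using 2(1)[OF w]
    by (simp add: sign_compose permutation_swap_id word_perm_permutation del: comp_apply)
qed simp

lemma carrier_braid_group:
  "carrier (braid_group m) = (\<lambda>w. braid_rel m `` {w}) ` braid_words m"
  by (auto simp: braid_group_def quotient_def)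

lemma braid_class_even_iff:
  assumes "w \<in> braid_words m"
  shows "braid_rel m `` {w} \<in> even_braids m \<longleftrightarrow> even (length w)"
  using assms
  by (auto simp: even_braids_def kernel_def carrier_braid_group braid_perm_class sign_word_perm
      sign_img_def minus_one_power_iff)

section \<open>Faces of homologous elements\<close>

context simplicial_group
begin

lemma face_one:
  assumes "j \<le> Suc n"
  shows "d (Suc n) j \<one>\<^bsub>G (Suc n)\<^esub> = \<one>\<^bsub>G n\<^esub>"
  using hom_one[OF face_hom[OF assms] group_G group_G] .

lemma face_closed:
  assumes "j \<le> Suc n" "x \<in> carrier (G (Suc n))"
  shows "d (Suc n) j x \<in> carrier (G n)"
  using hom_in_carrier[OF face_hom] assms by blast

text \<open>For \<open>y\<close> with \<open>d\<^sub>j\<^sub>+\<^sub>1 y = 1\<close>, the simplicial identity gives \<open>d\<^sub>j d\<^sub>0 y = d\<^sub>0 d\<^sub>j\<^sub>+\<^sub>1 y = 1\<close>.\<close>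

lemma boundaries_subset_cycles: "boundaries G d n \<subseteq> cycles G d n"
proof
  fix z assume "z \<in> boundaries G d n"
  then obtain y where y: "y \<in> carrier (G (Suc n))" and z: "z = d (Suc n) 0 y"
    and one: "\<And>j. 0 < j \<Longrightarrow> j \<le> Suc n \<Longrightarrow> d (Suc n) j y = \<one>\<^bsub>G n\<^esub>"
    by (auto simp: boundaries_def)
  have "d n j z = \<one>\<^bsub>G (n - 1)\<^esub>" if "n > 0" "j \<le> n" for j
  proof -
    obtain m where n: "n = Suc m"
      using \<open>n > 0\<close> by (cases n) auto
    have "d n j z = d n 0 (d (Suc n) (Suc j) y)"
      using face_face[of 0 "Suc j" m y] y that by (simp add: z n)
    then show ?thesis
      using one[of "Suc j"] face_one[of 0 m] that by (simp add: n)
  qed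
  then show "z \<in> cycles G d n"
    using face_closed y z by (simp add: cycles_def)
qed

lemma homologous_face_eq:
  assumes hom: "homologous G d (Suc n) x y" and j: "j \<le> Suc n"
    and x: "x \<in> carrier (G (Suc n))" and y: "y \<in> carrier (G (Suc n))"
  shows "d (Suc n) j x = d (Suc n) j y"
proof -
  interpret S: group "G (Suc n)" by (rule group_G)
  interpret T: group "G n" by (rule group_G)
  interpret f: group_hom "G (Suc n)" "G n" "d (Suc n) j"
    using face_hom[OF j] by unfold_locales
  have "d (Suc n) j (x \<otimes>\<^bsub>G (Suc n)\<^esub> inv\<^bsub>G (Suc n)\<^esub> y) = \<one>\<^bsub>G n\<^esub>"
    using hom boundaries_subset_cycles[of "Suc n"] j
    by (auto simp: homologous_def cycles_def)
  then have "d (Suc n) j x \<otimes>\<^bsub>G n\<^esub> inv\<^bsub>G n\<^esub> (d (Suc n) j y) = \<one>\<^bsub>G n\<^esub>"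
    using x y by simp
  then show ?thesis
    using x y T.inv_equality[of "d (Suc n) j x" "inv\<^bsub>G n\<^esub> (d (Suc n) j y)"] by simp
qed

end

section \<open>The braid action\<close>

context braided_simplicial_group
begin

lemma act_auto:
  assumes "\<sigma> \<in> carrier (braid_group (n + 1))"
  shows "act n \<sigma> \<in> hom (G n) (G n)" "bij_betw (act n \<sigma>) (carrier (G n)) (carrier (G n))"
  using hom_in_carrier[OF act_hom assms] by (auto simp: AutoGroup_def auto_def Bij_def)

lemma act_closed:
  assumes "\<sigma> \<in> carrier (braid_group (n + 1))" "x \<in> carrier (G n)"
  shows "act n \<sigma> x \<in> carrier (G n)"
  using hom_in_carrier[OF act_auto(1)] assms by blast

lemma act_mult:
  assumes \<sigma>: "\<sigma> \<in> carrier (braid_group (n + 1))" and \<tau>: "\<tau> \<in> carrier (braid_group (n + 1))"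
    and x: "x \<in> carrier (G n)"
  shows "act n (\<sigma> \<otimes>\<^bsub>braid_group (n + 1)\<^esub> \<tau>) x = act n \<sigma> (act n \<tau> x)"
proof -
  have "act n \<sigma> \<in> Bij (carrier (G n))" "act n \<tau> \<in> Bij (carrier (G n))"
    using hom_in_carrier[OF act_hom] \<sigma> \<tau> by (auto simp: AutoGroup_def auto_def)
  then show ?thesis
    using hom_mult[OF act_hom \<sigma> \<tau>] x by (simp add: AutoGroup_def BijGroup_def compose_def)
qed

lemma act_one:
  assumes "x \<in> carrier (G n)"
  shows "act n \<one>\<^bsub>braid_group (n + 1)\<^esub> x = x"
proof -
  have "act n \<one>\<^bsub>braid_group (n + 1)\<^esub> = \<one>\<^bsub>AutoGroup (G n)\<^esub>"
    by (intro hom_one[OF act_hom] group_braid_group group.AutoGroup group_G)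
  then show ?thesis
    using assms by (simp add: AutoGroup_def BijGroup_def)
qed

lemma act_class_append:
  assumes "v \<in> braid_words (n + 1)" "w \<in> braid_words (n + 1)" "x \<in> carrier (G n)"
  shows "act n (braid_rel (n + 1) `` {v @ w}) x =
    act n (braid_rel (n + 1) `` {v}) (act n (braid_rel (n + 1) `` {w}) x)"
  using act_mult[of "braid_rel (n + 1) `` {v}" n "braid_rel (n + 1) `` {w}" x] assms
  by (simp add: carrier_braid_group braid_mult_class)

lemma act_class_Nil:
  assumes "x \<in> carrier (G n)"
  shows "act n (braid_rel (n + 1) `` {[]}) x = x"
  using act_one[OF assms] by (simp add: braid_group_def)

lemma braid_gen_closed:
  assumes "k \<in> braid_labels m"
  shows "braid_gen m k \<in> carrier (braid_group m)"
  using assms by (auto simp: braid_gen_def carrier_braid_group braid_words_def)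

text \<open>
  Inverse generators interchange \<open>a\<close> and \<open>b\<close> as well, so a word acts on the pair by the parity
  of its length.
\<close>

lemma even_braids_fix_swapped_pair:
  assumes a: "a \<in> carrier (G n)" and b: "b \<in> carrier (G n)"
    and swap: "\<And>k. k \<in> braid_labels (n + 1) \<Longrightarrow> act n (braid_gen (n + 1) k) a = b"
      "\<And>k. k \<in> braid_labels (n + 1) \<Longrightarrow> act n (braid_gen (n + 1) k) b = a"
    and \<sigma>: "\<sigma> \<in> even_braids (n + 1)"
  shows "act n \<sigma> a = a"
proof -
  let ?cl = "\<lambda>w. braid_rel (n + 1) `` {w}"
  have letter: "act n (?cl [(k, e)]) a = b \<and> act n (?cl [(k, e)]) b = a"
    if k: "k \<in> braid_labels (n + 1)" for k e
  proof (cases e)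
    case True
    then show ?thesis
      using swap[OF k] by (simp add: braid_gen_def)
  next
    case False
    have words: "[(k, False)] \<in> braid_words (n + 1)" "[(k, True)] \<in> braid_words (n + 1)"
      using k by (auto simp: braid_words_def)
    have "?cl ([(k, False)] @ [(k, True)]) = ?cl []"
      using equiv_class_eq[OF equiv_braid_rel braid_rel.cancel[OF k, of False]] by simp
    then have inverse: "act n (?cl [(k, False)]) (act n (?cl [(k, True)]) y) = y"
      if "y \<in> carrier (G n)" for y
      using act_class_append[OF words that] act_class_Nil[OF that] by simp
    from inverse[OF a] inverse[OF b] show ?thesis
      using swap[OF k] False by (simp add: braid_gen_def)
  qed
  have word: "act n (?cl w) a = (if even (length w) then a else b)"
    if "w \<in> braid_words (n + 1)" for w
    using that
  proof (induction w)
    case Nil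
    show ?case
      using act_class_Nil[OF a] by simp
  next
    case (Cons l w)
    obtain k e where l: "l = (k, e)"
      by (cases l)
    have k: "k \<in> braid_labels (n + 1)" and w: "w \<in> braid_words (n + 1)"
      and l_word: "[(k, e)] \<in> braid_words (n + 1)"
      using Cons.prems by (auto simp: l braid_words_def)
    show ?case
      using act_class_append[OF l_word w a] Cons.IH[OF w] letter[OF k, of e] by (simp add: l)
  qed
  from \<sigma> obtain w where "w \<in> braid_words (n + 1)" "\<sigma> = ?cl w"
    by (auto simp: even_braids_def kernel_def carrier_braid_group)
  then show ?thesis
    using \<sigma> word braid_class_even_iff by simp
qed

section \<open>Faces of homologically fixed elements\<close>

lemma homologically_fixed_face:
  assumes x: "x \<in> homologically_fixed G d act (Suc n) (even_braids (Suc n + 1))"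
    and k: "k \<in> braid_labels (Suc n + 1)" and l: "l \<in> braid_labels (Suc n + 1)"
    and j: "j \<le> Suc n"
  shows "d (Suc n) j
      (act (Suc n) (braid_gen (Suc n + 1) k) (act (Suc n) (braid_gen (Suc n + 1) l) x)) =
    d (Suc n) j x"
proof -
  let ?\<sigma> = "braid_rel (Suc n + 1) `` {[(k, True)] @ [(l, True)]}"
  have carr: "x \<in> carrier (G (Suc n))"
    using x by (simp add: homologically_fixed_def)
  have words: "[(k, True)] \<in> braid_words (Suc n + 1)" "[(l, True)] \<in> braid_words (Suc n + 1)"
      "[(k, True)] @ [(l, True)] \<in> braid_words (Suc n + 1)"
    using k l by (auto simp: braid_words_def)
  have even: "?\<sigma> \<in> even_braids (Suc n + 1)"
    using braid_class_even_iff[OF words(3)] by simp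
  then have "homologous G d (Suc n) (act (Suc n) ?\<sigma> x) x"
    using x by (simp add: homologically_fixed_def)
  moreover have "act (Suc n) ?\<sigma> x \<in> carrier (G (Suc n))"
    using even carr by (intro act_closed) (auto simp: even_braids_def kernel_def)
  ultimately have "d (Suc n) j (act (Suc n) ?\<sigma> x) = d (Suc n) j x"
    using homologous_face_eq j carr by blast
  then show ?thesis
    using act_class_append[OF words(1,2) carr] by (simp add: braid_gen_def)
qed

text \<open>
  Moving \<open>d\<^sub>j\<close> past \<open>\<sigma>\<^sub>j\<^sub>-\<^sub>1 \<sigma>\<^sub>j\<close> shifts its index by one twice: \<open>d\<^sub>j \<sigma>\<^sub>j\<^sub>-\<^sub>1 \<sigma>\<^sub>j = d\<^sub>j\<^sub>+\<^sub>1 \<sigma>\<^sub>j = d\<^sub>j\<^sub>+\<^sub>2\<close>.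
\<close>

lemma face_shift_two:
  assumes x: "x \<in> homologically_fixed G d act (Suc n) (even_braids (Suc n + 1))"
    and j: "j + 2 \<le> Suc n"
  shows "d (Suc n) j x = d (Suc n) (j + 2) x"
proof -
  have carr: "x \<in> carrier (G (Suc n))"
    using x by (simp add: homologically_fixed_def)
  define y where "y = act (Suc n) (braid_gen (Suc n + 1) (int j)) x"
  have labels: "int j - 1 \<in> braid_labels (Suc n + 1)" "int j \<in> braid_labels (Suc n + 1)"
    using j by (auto simp: braid_labels_def)
  have "y \<in> carrier (G (Suc n))"
    unfolding y_def by (intro act_closed braid_gen_closed labels carr)
  then have "d (Suc n) j (act (Suc n) (braid_gen (Suc n + 1) (int j - 1)) y) = d (Suc n) (j + 1) y"
    using face_gen_left[of "int j - 1" "Suc n" y] j by (simp add: nat_add_distrib)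
  moreover have "d (Suc n) (j + 1) y = d (Suc n) (j + 2) x"
    using face_gen_left[of "int j" "Suc n" x] j carr by (simp add: y_def nat_add_distrib)
  ultimately show ?thesis
    using homologically_fixed_face[OF x labels, of j] j by (simp add: y_def)
qed

lemma face_parity:
  assumes x: "x \<in> homologically_fixed G d act (Suc n) (even_braids (Suc n + 1))"
    and j: "j \<le> Suc n"
  shows "d (Suc n) j x = d (Suc n) (j mod 2) x"
  using j
proof (induction j rule: less_induct)
  case (less j)
  show ?case
  proof (cases "j < 2")
    case False
    then obtain i where i: "j = i + 2"
      using le_Suc_ex[of 2 j] by (auto simp: add.commute)
    then show ?thesis
      using face_shift_two[OF x, of i] less.IH[of i] less.prems by simp
  qed simp
qed

text \<open>
  Only \<open>d\<^sub>0\<close> moves past every \<open>\<sigma>\<^sub>k\<^sub>+\<^sub>1\<close>: for \<open>k = - 1\<close>, the maps \<open>d\<^sub>1\<close> and \<open>\<sigma>\<^sub>0\<close> compose to \<open>d\<^sub>2\<close>.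
  Therefore the value of \<open>\<sigma>\<^sub>k\<close> at \<open>d\<^sub>0 x\<close> is not computed directly but found by cancelling \<open>\<sigma>\<^sub>k\<close> in
  \<open>\<sigma>\<^sub>k \<sigma>\<^sub>k d\<^sub>0 x = d\<^sub>0 x = \<sigma>\<^sub>k d\<^sub>1 x\<close>.
\<close>

lemma gen_swaps_faces:
  assumes x: "x \<in> homologically_fixed G d act (Suc n) (even_braids (Suc n + 1))"
    and k: "k \<in> braid_labels (n + 1)"
  shows "act n (braid_gen (n + 1) k) (d (Suc n) 1 x) = d (Suc n) 0 x" (is ?to0)
    and "act n (braid_gen (n + 1) k) (d (Suc n) 0 x) = d (Suc n) 1 x" (is ?to1)
proof -
  have carr: "x \<in> carrier (G (Suc n))"
    using x by (simp add: homologically_fixed_def)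
  define gen where "gen = (\<lambda>l. act (Suc n) (braid_gen (Suc n + 1) l))"
  have labels: "- 1 \<in> braid_labels (Suc n + 1)" "k + 1 \<in> braid_labels (Suc n + 1)"
    using k by (auto simp: braid_labels_def)
  have gen_x: "gen (- 1) x \<in> carrier (G (Suc n))" "gen (k + 1) x \<in> carrier (G (Suc n))"
    unfolding gen_def by (intro act_closed braid_gen_closed labels carr)+
  have face0: "d (Suc n) 0 (gen (k + 1) y) = act n (braid_gen (n + 1) k) (d (Suc n) 0 y)"
    if "y \<in> carrier (G (Suc n))" for y
    using face_gen_low[of "k + 1" "Suc n" 0 y] k that by (simp add: gen_def braid_labels_def)
  have "d (Suc n) 0 (gen (- 1) x) = d (Suc n) 1 x"
    using face_gen_left[of "- 1" "Suc n" x] k carr by (simp add: gen_def braid_labels_def)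
  then show to0: ?to0
    using homologically_fixed_face[OF x labels(2,1), of 0] face0[OF gen_x(1)]
    by (simp add: gen_def)
  have twice: "act n (braid_gen (n + 1) k) (act n (braid_gen (n + 1) k) (d (Suc n) 0 x)) = d (Suc n) 0 x"
    using homologically_fixed_face[OF x labels(2,2), of 0] face0[OF gen_x(2)] face0[OF carr]
    by (simp add: gen_def)
  have gen: "braid_gen (n + 1) k \<in> carrier (braid_group (n + 1))"
    by (rule braid_gen_closed[OF k])
  show ?to1
  proof (rule inj_onD[OF bij_betw_imp_inj_on[OF act_auto(2)[OF gen]]])
    show "act n (braid_gen (n + 1) k) (act n (braid_gen (n + 1) k) (d (Suc n) 0 x)) =
        act n (braid_gen (n + 1) k) (d (Suc n) 1 x)"
      using twice to0 by simp
  qed (use face_closed carr act_closed gen in simp_all)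
qed

end

theorem proposition2p10:
  fixes G :: "nat \<Rightarrow> 'a monoid"
    and d s :: "nat \<Rightarrow> nat \<Rightarrow> 'a \<Rightarrow> 'a"
    and act :: "nat \<Rightarrow> braid_word set \<Rightarrow> 'a \<Rightarrow> 'a"
    and n :: nat and x :: 'a
  assumes "braided_simplicial_group G d s act"
    and "n \<ge> 2"
    and "x \<in> homologically_fixed G d act n (even_braids (n + 1))"
  shows "(\<forall>j. j \<le> n - 2 \<longrightarrow> d n j x = d n (j + 2) x) \<and>
    (\<forall>j k. j \<le> n - 1 \<and> - 1 \<le> k \<and> k \<le> int n - 3 \<longrightarrow>
      act (n - 1) (braid_gen n k) (d n j x) = d n (j + 1) x) \<and>
    (\<forall>j\<le>n. d n j x \<in> carrier (G (n - 1)) \<and>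
      (\<forall>\<sigma>\<in>even_braids n. act (n - 1) \<sigma> (d n j x) = d n j x)) \<and>
    ((\<exists>j\<le>n. d n j x = \<one>\<^bsub>G (n - 1)\<^esub>) \<longrightarrow> x \<in> cycles G d n)"
proof -
  interpret braided_simplicial_group G d s act
    by (rule assms(1))
  obtain m where n: "n = Suc m" and m: "m \<ge> 1"
    using assms(2) by (cases n) auto
  have x: "x \<in> homologically_fixed G d act (Suc m) (even_braids (Suc m + 1))"
    using assms(3) by (simp add: n)
  then have carr: "x \<in> carrier (G (Suc m))"
    by (simp add: homologically_fixed_def)
  have face_carr: "d (Suc m) j x \<in> carrier (G m)" if "j \<le> Suc m" for j
    using face_closed that carr by blast
  have swap: "act m (braid_gen (m + 1) k) (d (Suc m) j x) = d (Suc m) (1 - j mod 2) x"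
    if "k \<in> braid_labels (m + 1)" "j \<le> Suc m" for j k
    using gen_swaps_faces[OF x that(1)] face_parity[OF x that(2)]
    by (cases "even j") (simp_all add: even_iff_mod_2_eq_zero odd_iff_mod_2_eq_one)
  have next_face: "d (Suc m) (1 - j mod 2) x = d (Suc m) (j + 1) x" if "j \<le> m" for j
    using face_parity[OF x, of "j + 1"] that
    by (cases "even j") (simp_all add: even_iff_mod_2_eq_zero odd_iff_mod_2_eq_one mod_Suc)
  have fixed: "act m \<sigma> (d (Suc m) j x) = d (Suc m) j x"
    if \<sigma>: "\<sigma> \<in> even_braids (m + 1)" and j: "j \<le> Suc m" for \<sigma> j
  proof (rule even_braids_fix_swapped_pair[OF _ _ _ _ \<sigma>])
    fix k assume k: "k \<in> braid_labels (m + 1)"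
    show "act m (braid_gen (m + 1) k) (d (Suc m) j x) = d (Suc m) (1 - j mod 2) x"
      by (rule swap[OF k j])
    show "act m (braid_gen (m + 1) k) (d (Suc m) (1 - j mod 2) x) = d (Suc m) j x"
      using swap[OF k, of "1 - j mod 2"] face_parity[OF x j]
      by (cases "even j") (simp_all add: even_iff_mod_2_eq_zero odd_iff_mod_2_eq_one)
  qed (use face_carr j in simp_all)
  have cycle: "x \<in> cycles G d (Suc m)" if j: "j \<le> Suc m" "d (Suc m) j x = \<one>\<^bsub>G m\<^esub>" for j
  proof -
    have label: "- 1 \<in> braid_labels (m + 1)"
      using m by (simp add: braid_labels_def)
    have "act m (braid_gen (m + 1) (- 1)) \<one>\<^bsub>G m\<^esub> = \<one>\<^bsub>G m\<^esub>"
      using hom_one[OF act_auto(1)[OF braid_gen_closed[OF label]] group_G group_G] .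
    then have "d (Suc m) (1 - j mod 2) x = \<one>\<^bsub>G m\<^esub>"
      using swap[OF label j(1)] j(2) by simp
    moreover have "d (Suc m) (j mod 2) x = \<one>\<^bsub>G m\<^esub>"
      using face_parity[OF x j(1)] j(2) by simp
    moreover have "i mod 2 = j mod 2 \<or> i mod 2 = 1 - j mod 2" for i :: nat
      by presburger
    ultimately have "d (Suc m) i x = \<one>\<^bsub>G m\<^esub>" if "i \<le> Suc m" for i
      using face_parity[OF x that] by metis
    then show ?thesis
      using carr by (simp add: cycles_def)
  qed
  show ?thesis
  proof (intro conjI allI impI ballI)
    show "d n j x = d n (j + 2) x" if "j \<le> n - 2" for j
      using face_shift_two[OF x, of j] that m by (simp add: n)
    show "act (n - 1) (braid_gen n k) (d n j x) = d n (j + 1) x"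
      if "j \<le> n - 1 \<and> - 1 \<le> k \<and> k \<le> int n - 3" for j k
      using swap[of k j] next_face[of j] that by (simp add: n braid_labels_def)
    show "d n j x \<in> carrier (G (n - 1))" if "j \<le> n" for j
      using face_carr that by (simp add: n)
    show "act (n - 1) \<sigma> (d n j x) = d n j x" if "j \<le> n" "\<sigma> \<in> even_braids n" for j \<sigma>
      using fixed that by (simp add: n)
    show "x \<in> cycles G d n" if "\<exists>j\<le>n. d n j x = \<one>\<^bsub>G (n - 1)\<^esub>"
      using cycle that by (auto simp: n)
  qed
qed

end
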